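(* There exists a universal constant $\varepsilon_0 > 0$ such that the following holds. If $X$ is a smooth, closed, strictly convex curve in $\mathbb{R}^2$ with curvature $\kappa$ satisfying $$1 - \varepsilon_0 \leq \frac{\mathrm{length}(X)}{2\pi } \min_{x \in X} \kappa(x) \leq \frac{\mathrm{length}(X)}{2\pi } \max_{x \in X} \kappa(x) \leq 1 + \varepsilon_0,$$ then there exists a Borel probability measure $\mu$ on $X$ such that $$ X \ni x \mapsto \int_{X} \| x- y\| \, d\mu(y)$$ is constant on $X$.
   Context: $\|\cdot\|$ denotes the Euclidean norm on $\mathbb{R}^2$. A closed, strictly convex curve is a simple closed planar curve that is the boundary of a bounded convex region and contains no line segment. $\mathrm{length}(X)$ is the total arclength of $X$, and $\kappa(x)$ is the usual curvature of the planar curve $X$ at $x\in X$, signed so that it is nonnegative for a convex curve. *)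

theory Defs
  imports "HOL-Probability.Probability"
begin

definition velocity :: "(real \<Rightarrow> real^2) \<Rightarrow> real \<Rightarrow> real^2" where
  "velocity \<gamma> t = vector_derivative \<gamma> (at t)"

text \<open>\<open>C\<^sup>\<infinity>\<close> on the whole line: every iterated derivative is again differentiable everywhere.\<close>

definition smooth_map :: "(real \<Rightarrow> real^2) \<Rightarrow> bool" where
  "smooth_map \<gamma> \<longleftrightarrow> (\<forall>n t. (velocity ^^ n) \<gamma> differentiable at t)"

definition rot90 :: "real^2 \<Rightarrow> real^2" where
  "rot90 v = vector [- (v $ 2), v $ 1]"

text \<open>A smooth closed curve is represented by a regular 1-periodic parametrization
  \<open>\<gamma>\<close> of the whole line. Periodicity makes the curve smooth at the base point \<open>\<gamma> 0 = \<gamma> 1\<close> too.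
  Simplicity concerns the single period \<open>{0..1}\<close>.
  The last condition fixes the counterclockwise orientation: the bounded component
  of the complement lies to the left of the direction of travel.\<close>

definition smooth_closed_parametrization :: "(real \<Rightarrow> real^2) \<Rightarrow> (real^2) set \<Rightarrow> bool" where
  "smooth_closed_parametrization \<gamma> X \<longleftrightarrow>
     smooth_map \<gamma> \<and>
     (\<forall>t. velocity \<gamma> t \<noteq> 0) \<and>
     (\<forall>t. \<gamma> (t + 1) = \<gamma> t) \<and>
     simple_path \<gamma> \<and>
     path_image \<gamma> = X \<and>
     (\<forall>t. eventually (\<lambda>s. \<gamma> t + s *\<^sub>R rot90 (velocity \<gamma> t) \<in> inside X) (at_right 0))"

definition strictly_convex_curve :: "(real^2) set \<Rightarrow> bool" where
  "strictly_convex_curve X \<longleftrightarrow>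
     (\<exists>C. open C \<and> C \<noteq> {} \<and> bounded C \<and> convex C \<and> frontier C = X) \<and>
     (\<forall>a b. a \<noteq> b \<longrightarrow> \<not> closed_segment a b \<subseteq> X)"

definition curve_length :: "(real \<Rightarrow> real^2) \<Rightarrow> real" where
  "curve_length \<gamma> = integral {0..1} (\<lambda>t. norm (velocity \<gamma> t))"

text \<open>Signed curvature \<open>det(\<gamma>', \<gamma>'') / \<parallel>\<gamma>'\<parallel>\<^sup>3\<close> at the parameter \<open>t\<close>; for the counterclockwise
  parametrizations above it is nonnegative on convex curves.\<close>

definition signed_curvature :: "(real \<Rightarrow> real^2) \<Rightarrow> real \<Rightarrow> real" where
  "signed_curvature \<gamma> t =
     (velocity \<gamma> t $ 1 * velocity (velocity \<gamma>) t $ 2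
      - velocity \<gamma> t $ 2 * velocity (velocity \<gamma>) t $ 1) / norm (velocity \<gamma> t) ^ 3"

end

theory Submission
  imports Defs
begin

text \<open>
  The measure is a limit of discrete equilibrium measures. On a finite set of curve points, take the probability
  weights of maximal energy \<open>\<Sum> m a * m b * \<parallel>a - b\<parallel>\<close>. By the first-order condition
  (\<open>energy_maximizer\<close>), their potential takes its maximum over the set at every point of the support.
  The crucial fact is geometric: if the maximal curvature is less than twice the minimal one, then
  the distance to a fixed point \<open>p\<close> of the curve is a strictly concave function of arclength
  away from \<open>p\<close> (\<open>slope_deriv\<close>). Indeed, if \<open>d\<close> is the distance from \<open>x\<close> to \<open>p\<close> and \<open>y > 0\<close> is the height
  of \<open>p\<close> above the tangent at \<open>x\<close>, the second derivative is \<open>y * (y - \<kappa> * d\<^sup>2) / d\<^sup>3\<close>; the rolling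
  principle (\<open>outside_tangent_disc\<close>) bounds \<open>y\<close> by \<open>\<kappa>\<^sub>m\<^sub>a\<^sub>x * d\<^sup>2 / 2\<close>, which is less than
  \<open>\<kappa> * d\<^sup>2\<close>. Hence the potential has no minimum off the support
  (\<open>not_minimal_off_support\<close>). Its minimum over the whole curve lies on the support, where the
  potential equals its maximum over the finite set, so it is constant on that set (\<open>equalizing_weights\<close>).

  For finer and finer grids, Helly's theorem yields a weak limit of these measures on the parameter line. Potentials
  are 1-Lipschitz, so the potential of the limit is constant (\<open>equalizing_distribution\<close>).

  The hypothesis with \<open>\<epsilon>\<^sub>0 = 1/4\<close> supplies what this needs (\<open>curve_turns\<close>): the pinching of the
  curvature, and total turning \<open>2 * pi\<close>, since the total turning is a multiple of
  \<open>2 * pi\<close> that differs from \<open>2 * pi\<close> by at most \<open>pi / 2\<close>.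
\<close>

section \<open>Energy-maximizing weights on a finite set\<close>

text \<open>The weights are a maximizer of the energy \<open>\<Sum> m a * m b * k a b\<close> over the simplex,
  and the last conclusion is its first-order condition: moving a little mass from \<open>a\<close> to \<open>b\<close>
  changes the energy at first order by a positive multiple of the potential at \<open>b\<close>
  minus the potential at \<open>a\<close>.\<close>
lemma energy_maximizer:
  fixes k :: "'a \<Rightarrow> 'a \<Rightarrow> real"
  assumes fin: "finite A" and ne: "A \<noteq> {}" and sym: "\<And>a b. k a b = k b a"
  obtains m where "\<And>a. m a \<ge> 0" "(\<Sum>a\<in>A. m a) = 1"
    "\<And>a b. \<lbrakk>a \<in> A; b \<in> A; m a > 0\<rbrakk> \<Longrightarrow> (\<Sum>c\<in>A. m c * k b c) \<le> (\<Sum>c\<in>A. m c * k a c)"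
proof -
  define U where "U m a = (\<Sum>c\<in>A. m c * k a c)" for m a
  define E where "E m = (\<Sum>a\<in>A. m a * U m a)" for m
  \<comment> \<open>Off \<open>A\<close> the weights are free in \<open>[0,1]\<close>: this keeps \<open>S\<close> a closed part of a Tychonoff cube.\<close>
  define S where "S = (\<Pi>\<^sub>E a\<in>UNIV. {0..1::real}) \<inter> {m. (\<Sum>a\<in>A. m a) = 1}"
  have "compact (\<Pi>\<^sub>E a\<in>(UNIV::'a set). {0..1::real})"
    using compactin_PiE[of "\<lambda>_. euclidean" "UNIV :: 'a set" "\<lambda>_. {0..1::real}"]
    by (simp add: euclidean_product_topology)
  moreover have "closed {m :: 'a \<Rightarrow> real. (\<Sum>a\<in>A. m a) = 1}"
    by (intro closed_Collect_eq continuous_intros) auto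
  ultimately have "compact S"
    unfolding S_def by (rule compact_Int_closed)
  moreover have "S \<noteq> {}"
  proof -
    obtain a where a: "a \<in> A" using ne by blast
    have "(\<lambda>b. if b = a then 1 else 0) \<in> S"
      using a fin by (auto simp: S_def)
    then show ?thesis by blast
  qed
  moreover have "continuous_on S E"
    unfolding E_def U_def
    by (intro continuous_intros continuous_on_subset[OF continuous_on_product_coordinates]) auto
  ultimately obtain m where m: "m \<in> S" and max: "\<And>m'. m' \<in> S \<Longrightarrow> E m' \<le> E m"
    using continuous_attains_sup[of S E] by blast
  have m01: "0 \<le> m a" "m a \<le> 1" for a
    using m by (auto simp: S_def PiE_def Pi_def)
  have m1: "(\<Sum>a\<in>A. m a) = 1"
    using m by (simp add: S_def)
  have "U m b \<le> U m a" if a: "a \<in> A" and b: "b \<in> A" and pos: "m a > 0" for a b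
  proof (rule ccontr)
    assume "\<not> U m b \<le> U m a"
    then have g: "U m b - U m a > 0" (is "?g > 0") by simp
    then have ab: "a \<noteq> b" by auto
    define v where "v c = (if c = b then 1 else if c = a then -1 else 0::real)" for c
    have vsum: "(\<Sum>c\<in>A. v c * f c) = f b - f a" for f
    proof -
      have "(\<Sum>c\<in>A. v c * f c) = (\<Sum>c\<in>{a,b}. v c * f c)"
        using a b fin by (intro sum.mono_neutral_right) (auto simp: v_def)
      then show ?thesis using ab by (simp add: v_def)
    qed
    define Q where "Q = (\<Sum>c\<in>A. v c * U v c)"
    \<comment> \<open>Small enough for the quadratic term \<open>d\<^sup>2 * Q\<close> not to outweigh the linear gain \<open>2 * d * (U m b - U m a)\<close>.\<close>
    define d where "d = min (m a) (?g / (\<bar>Q\<bar> + 1))"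
    have "d \<le> ?g / (\<bar>Q\<bar> + 1)"
      by (simp add: d_def)
    then have "d * (\<bar>Q\<bar> + 1) \<le> ?g"
      by (subst (asm) pos_le_divide_eq) auto
    moreover have "d > 0" "d \<le> m a"
      using pos g by (auto simp: d_def intro!: divide_pos_pos add_nonneg_pos)
    ultimately have d: "d > 0" "d \<le> m a" "d * (\<bar>Q\<bar> + 1) \<le> ?g" by auto
    have U_add: "U (\<lambda>c. m c + d * v c) x = U m x + d * U v x" for x
      by (simp add: U_def algebra_simps sum.distrib sum_distrib_left)
    have "(\<Sum>c\<in>A. m c * U v c) = (\<Sum>c\<in>A. v c * U m c)"
      unfolding U_def sum_distrib_left
      by (subst sum.swap) (intro sum.cong refl, simp add: sym mult_ac)
    then have mU: "(\<Sum>c\<in>A. m c * U v c) = ?g"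
      using vsum[of "U m"] by simp
    have "E (\<lambda>c. m c + d * v c)
        = E m + d * (\<Sum>c\<in>A. v c * U m c) + d * (\<Sum>c\<in>A. m c * U v c) + d * (d * Q)"
      unfolding E_def U_add Q_def by (simp add: algebra_simps sum.distrib sum_distrib_left)
    then have "E (\<lambda>c. m c + d * v c) = E m + 2 * d * ?g + d * (d * Q)"
      unfolding mU vsum by (simp add: algebra_simps)
    moreover have "(\<lambda>c. m c + d * v c) \<in> S"
    proof -
      have "m a + m b \<le> 1"
        using sum_mono2[of A "{a,b}" m] a b fin ab m01 m1 by auto
      then have "0 \<le> m c + d * v c \<and> m c + d * v c \<le> 1" for c
        using m01[of c] m01[of b] d by (auto simp: v_def)
      moreover have "(\<Sum>c\<in>A. m c + d * v c) = 1"
        using vsum[of "\<lambda>_. d"] m1 by (simp add: sum.distrib mult.commute)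
      ultimately show ?thesis by (simp add: S_def PiE_iff)
    qed
    ultimately have "2 * d * ?g + d * (d * Q) \<le> 0"
      using max by fastforce
    then have "d * (2 * ?g + d * Q) \<le> 0"
      by (simp add: algebra_simps)
    then have "2 * ?g + d * Q \<le> 0"
      using d(1) by (simp add: mult_le_0_iff)
    moreover have "d * (- Q) \<le> d * (\<bar>Q\<bar> + 1)"
      using d(1) by (intro mult_left_mono) auto
    then have "d * (- Q) \<le> ?g"
      using d(3) by (rule order_trans)
    ultimately show False
      using g by simp
  qed
  then show thesis
    using that[of m] m01 m1 unfolding U_def by blast
qed

section \<open>Closed curves with pinched curvature\<close>

lemma quasiperiodic_int:
  fixes f :: "real \<Rightarrow> 'a::real_vector"
  assumes step: "\<And>t. f (t + 1) = f t + c"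
  shows "f (t + of_int k) = f t + of_int k *\<^sub>R c"
proof -
  have nat: "f (t + of_nat n) = f t + of_nat n *\<^sub>R c" for t n
  proof (induction n)
    case (Suc n)
    then show ?case
      using step[of "t + of_nat n"] by (simp add: add_ac scaleR_left_distrib)
  qed simp
  obtain n where "k = int n \<or> k = - int n"
    by (metis int_cases2)
  then show ?thesis
    using nat[of t n] nat[of "t - of_nat n" n] by (auto simp: algebra_simps)
qed

lemma periodic_frac:
  fixes f :: "real \<Rightarrow> 'a::real_vector"
  assumes "\<And>t. f (t + 1) = f t"
  shows "f (frac t) = f t"
  using quasiperiodic_int[of f 0 t "- \<lfloor>t\<rfloor>"] assms by (simp add: frac_def)

text \<open>Unit vectors are recorded by their angle: for a tangent \<open>dir a\<close> of a counterclockwise convex curve,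
  \<open>dir (a + pi/2)\<close> is the inner and \<open>dir (a - pi/2)\<close> the outer normal.\<close>
definition dir :: "real \<Rightarrow> real^2" where
  "dir a = vector [cos a, sin a]"

lemma inner_real2: "inner (u :: real^2) v = u $ 1 * v $ 1 + u $ 2 * v $ 2"
  by (simp add: inner_vec_def sum_2)

lemma inner_dir_dir: "inner (dir a) (dir b) = cos (a - b)"
  by (simp add: dir_def inner_real2 cos_diff)

lemma norm_dir [simp]: "norm (dir a) = 1"
  by (simp add: norm_eq_sqrt_inner inner_dir_dir)

lemma pythagoras_dir: "(inner v (dir a))\<^sup>2 + (inner v (dir (a + pi/2)))\<^sup>2 = (norm v)\<^sup>2"
proof -
  have "(inner v (dir a))\<^sup>2 + (inner v (dir (a + pi/2)))\<^sup>2
      = ((v$1)\<^sup>2 + (v$2)\<^sup>2) * ((sin a)\<^sup>2 + (cos a)\<^sup>2)"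
    by (simp only: inner_real2 dir_def vector_2 cos_add sin_add cos_pi_half sin_pi_half) algebra
  also have "\<dots> = (norm v)\<^sup>2"
    by (simp add: power2_norm_eq_inner inner_real2 flip: power2_eq_square)
  finally show ?thesis .
qed

text \<open>A closed curve with speed \<open>w\<close>, tangent angle \<open>\<theta>\<close>, curvature \<open>\<kappa>\<close> and total turning \<open>2 * pi\<close>.
  The last two assumptions are the pinching that the argument uses: some upper bound \<open>K\<close> of the
  curvature is less than twice the curvature at every point.\<close>
locale turning_curve =
  fixes \<gamma> :: "real \<Rightarrow> real^2" and w \<theta> \<kappa> :: "real \<Rightarrow> real" and K :: real
  assumes gamma_deriv: "\<And>t. (\<gamma> has_vector_derivative w t *\<^sub>R dir (\<theta> t)) (at t)"
    and theta_deriv: "\<And>t. (\<theta> has_real_derivative \<kappa> t * w t) (at t)"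
    and speed_pos: "\<And>t. w t > 0"
    and periodic: "\<And>t. \<gamma> (t + 1) = \<gamma> t"
    and turn: "\<And>t. \<theta> (t + 1) = \<theta> t + 2 * pi"
    and curv_le: "\<And>t. \<kappa> t \<le> K"
    and pinched: "\<And>t. K < 2 * \<kappa> t"
begin

lemma curv_pos: "\<kappa> t > 0"
  using curv_le[of t] pinched[of t] by linarith

lemma K_pos: "K > 0"
  using curv_le[of 0] curv_pos[of 0] by linarith

lemma inner_deriv:
  "((\<lambda>s. inner (\<gamma> s) v) has_real_derivative w t * inner (dir (\<theta> t)) v) (at t)"
proof -
  have "((\<lambda>s. inner (\<gamma> s) v) has_derivative (\<lambda>x. inner (x *\<^sub>R w t *\<^sub>R dir (\<theta> t)) v)) (at t)"
    using gamma_deriv[of t] unfolding has_vector_derivative_def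
    by (rule has_derivative_inner_left)
  moreover have "(\<lambda>x. inner (x *\<^sub>R w t *\<^sub>R dir (\<theta> t)) v) = (*) (w t * inner (dir (\<theta> t)) v)"
    by (simp add: fun_eq_iff)
  ultimately show ?thesis
    by (simp add: has_field_derivative_def)
qed

lemma gamma_cont [continuous_intros]: "isCont \<gamma> t"
  using gamma_deriv[of t] has_vector_derivative_continuous by blast

lemma theta_strict_mono: "s < t \<Longrightarrow> \<theta> s < \<theta> t"
  by (rule DERIV_pos_imp_increasing)
    (use theta_deriv curv_pos speed_pos in \<open>auto intro!: exI\<close>)

lemma periodic_int: "\<gamma> (t + of_int k) = \<gamma> t" "\<theta> (t + of_int k) = \<theta> t + 2 * pi * of_int k"
  using quasiperiodic_int[of \<gamma> 0 t k] periodic quasiperiodic_int[of \<theta> "2 * pi" t k] turn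
  by simp_all

lemma gamma_frac: "\<gamma> (frac t) = \<gamma> t"
  using periodic by (rule periodic_frac)

text \<open>A point of the curve has parameters in every period, and one of them has a tangent
  angle within a half turn of any given angle. From there on, the sign of the sine of an angle
  difference is known along the whole arc between the two parameters.\<close>
lemma nearby_parameter:
  obtains u' where "\<gamma> u' = \<gamma> u" "\<bar>\<theta> u' - \<theta> t\<bar> \<le> pi"
proof -
  define k where "k = round ((\<theta> t - \<theta> u) / (2 * pi))"
  have "\<bar>of_int k - (\<theta> t - \<theta> u) / (2 * pi)\<bar> \<le> 1/2"
    unfolding k_def by (rule of_int_round_abs_le)
  then have "2 * pi * \<bar>of_int k - (\<theta> t - \<theta> u) / (2 * pi)\<bar> \<le> 2 * pi * (1/2)"
    by (intro mult_left_mono) auto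
  also have "2 * pi * \<bar>of_int k - (\<theta> t - \<theta> u) / (2 * pi)\<bar>
      = \<bar>2 * pi * (of_int k - (\<theta> t - \<theta> u) / (2 * pi))\<bar>"
    by (simp add: abs_mult)
  also have "2 * pi * (of_int k - (\<theta> t - \<theta> u) / (2 * pi)) = \<theta> (u + of_int k) - \<theta> t"
    by (simp add: periodic_int field_simps)
  finally show thesis
    using that[of "u + of_int k"] periodic_int(1)[of u k] by simp
qed

text \<open>The height \<open>B\<close> in the direction of the inner normal at \<open>t\<close> has derivative
  \<open>w s * sin (\<theta> s - \<theta> t)\<close>, so it increases away from \<open>t\<close> through a half turn in either direction.\<close>
lemma strictly_left:
  assumes "u \<noteq> t" "\<bar>\<theta> u - \<theta> t\<bar> \<le> pi"
  shows "inner (\<gamma> u) (dir (\<theta> t + pi/2)) > inner (\<gamma> t) (dir (\<theta> t + pi/2))"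
proof -
  define B where "B s = inner (\<gamma> s) (dir (\<theta> t + pi/2))" for s
  have B': "(B has_real_derivative w s * sin (\<theta> s - \<theta> t)) (at s)" for s
    unfolding B_def using inner_deriv[of "dir (\<theta> t + pi/2)" s]
    by (simp add: inner_dir_dir cos_diff sin_diff cos_add sin_add)
  then have cont: "continuous_on I B" for I
    by (meson DERIV_isCont continuous_at_imp_continuous_on)
  consider "t < u" | "u < t" using assms(1) by linarith
  then have "B t < B u"
  proof cases
    case 1
    show ?thesis
    proof (rule DERIV_pos_imp_increasing_open[OF 1 _ cont])
      fix s assume s: "t < s" "s < u"
      then have "0 < \<theta> s - \<theta> t" "\<theta> s - \<theta> t < pi"
        using theta_strict_mono[of t s] theta_strict_mono[of s u] assms(2) by linarith+
      then show "\<exists>y. (B has_real_derivative y) (at s) \<and> 0 < y"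
        using B' speed_pos sin_gt_zero by (meson mult_pos_pos)
    qed
  next
    case 2
    show ?thesis
    proof (rule DERIV_neg_imp_decreasing_open[OF 2 _ cont])
      fix s assume s: "u < s" "s < t"
      then have "0 < \<theta> t - \<theta> s" "\<theta> t - \<theta> s < pi"
        using theta_strict_mono[of s t] theta_strict_mono[of u s] assms(2) by linarith+
      then have "sin (\<theta> t - \<theta> s) > 0" by (rule sin_gt_zero)
      then have "sin (\<theta> s - \<theta> t) < 0" by (metis minus_diff_eq neg_less_0_iff_less sin_minus)
      then show "\<exists>y. (B has_real_derivative y) (at s) \<and> y < 0"
        using B' speed_pos by (meson mult_pos_neg)
    qed
  qed
  then show ?thesis by (simp add: B_def)
qed

text \<open>Blaschke's rolling principle: the curve avoids the open disc of radius \<open>1 / K\<close> that touches it from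
  inside at \<open>\<gamma> t\<close>. Compare the curve with the circle of this radius at points with equal tangent
  direction. In the outward normal direction \<open>\<nu>\<close> at \<open>u\<close>, the curve advances at least as far as
  the circle, since its radius of curvature is nowhere smaller; at \<open>u\<close> the circle is at distance
  \<open>1 / K\<close> from its centre in this direction, hence \<open>\<gamma> u\<close> is at least as far from the centre.\<close>
lemma outside_tangent_disc:
  assumes "\<bar>\<theta> u - \<theta> t\<bar> \<le> pi"
  shows "2 * inner (\<gamma> u - \<gamma> t) (dir (\<theta> t + pi/2)) \<le> K * (norm (\<gamma> u - \<gamma> t))\<^sup>2"
proof -
  define \<nu> where "\<nu> = dir (\<theta> u - pi/2)"
  \<comment> \<open>\<open>K\<close> times the component along \<open>\<nu>\<close> of the curve minus the circle.\<close>
  define B where "B s = K * inner (\<gamma> s) \<nu> - cos (\<theta> s - \<theta> u)" for s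
  have B': "(B has_real_derivative w s * (K - \<kappa> s) * sin (\<theta> u - \<theta> s)) (at s)" for s
    unfolding B_def
    by (rule derivative_eq_intros inner_deriv theta_deriv refl)+
      (simp add: \<nu>_def inner_dir_dir cos_diff sin_diff cos_add sin_add algebra_simps)
  have wK: "w s * (K - \<kappa> s) \<ge> 0" for s
    using speed_pos[of s] curv_le[of s] by simp
  have mono: "\<theta> s \<le> \<theta> t" if "s \<le> t" for s t
    using theta_strict_mono[of s t] that by (cases "s = t") auto
  have "B t \<le> B u"
  proof (cases "t \<le> u")
    case True
    then show ?thesis
    proof (rule DERIV_nonneg_imp_nondecreasing)
      fix s assume s: "t \<le> s" "s \<le> u"
      then have "0 \<le> \<theta> u - \<theta> s" "\<theta> u - \<theta> s \<le> pi"
        using mono[of t s] mono[of s u] assms by linarith+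
      then show "\<exists>y. (B has_real_derivative y) (at s) \<and> 0 \<le> y"
        using B' wK sin_ge_zero by (meson mult_nonneg_nonneg)
    qed
  next
    case False
    then have "u \<le> t" by simp
    then show ?thesis
    proof (rule DERIV_nonpos_imp_nonincreasing)
      fix s assume s: "u \<le> s" "s \<le> t"
      then have "0 \<le> \<theta> s - \<theta> u" "\<theta> s - \<theta> u \<le> pi"
        using mono[of u s] mono[of s t] assms by linarith+
      then have "sin (\<theta> s - \<theta> u) \<ge> 0" by (rule sin_ge_zero)
      then have "sin (\<theta> u - \<theta> s) \<le> 0"
        by (metis minus_diff_eq neg_0_le_iff_le sin_minus minus_minus)
      then show "\<exists>y. (B has_real_derivative y) (at s) \<and> y \<le> 0"
        using B' wK by (meson mult_nonneg_nonpos)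
    qed
  qed
  then have "1 \<le> inner (K *\<^sub>R (\<gamma> u - \<gamma> t) - dir (\<theta> t + pi/2)) \<nu>"
    by (simp add: B_def \<nu>_def inner_diff_left inner_dir_dir cos_diff cos_add sin_add algebra_simps)
  also have "\<dots> \<le> norm (K *\<^sub>R (\<gamma> u - \<gamma> t) - dir (\<theta> t + pi/2))"
    using norm_cauchy_schwarz[of _ \<nu>] by (simp add: \<nu>_def)
  finally have "1\<^sup>2 \<le> (norm (K *\<^sub>R (\<gamma> u - \<gamma> t) - dir (\<theta> t + pi/2)))\<^sup>2"
    by (intro power_mono) auto
  also have "\<dots> = K\<^sup>2 * (norm (\<gamma> u - \<gamma> t))\<^sup>2 + 1 - 2 * K * inner (\<gamma> u - \<gamma> t) (dir (\<theta> t + pi/2))"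
    unfolding power2_norm_eq_inner
    by (simp add: inner_diff_left inner_diff_right inner_dir_dir inner_commute algebra_simps power2_eq_square)
  finally have "K * (2 * inner (\<gamma> u - \<gamma> t) (dir (\<theta> t + pi/2))) \<le> K * (K * (norm (\<gamma> u - \<gamma> t))\<^sup>2)"
    by (simp add: power2_eq_square algebra_simps)
  then show ?thesis
    using K_pos by simp
qed

end

section \<open>Concavity of the distance and discrete potentials\<close>

context turning_curve begin

text \<open>The arclength derivative of the distance to \<open>p\<close>. Working with it, rather than with the second
  derivative of the distance in the given parameter, avoids reparametrizing by arclength.\<close>
definition slope :: "real^2 \<Rightarrow> real \<Rightarrow> real" where
  "slope p t = inner (\<gamma> t - p) (dir (\<theta> t)) / norm (\<gamma> t - p)"

lemma component_deriv:
  "((\<lambda>s. \<gamma> s $ 1) has_real_derivative w t * cos (\<theta> t)) (at t)"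
  "((\<lambda>s. \<gamma> s $ 2) has_real_derivative w t * sin (\<theta> t)) (at t)"
  using inner_deriv[of "dir 0" t] inner_deriv[of "dir (pi/2)" t]
  by (simp_all add: inner_real2 dir_def)

lemma norm_deriv:
  assumes "\<gamma> t \<noteq> p"
  shows "((\<lambda>s. norm (\<gamma> s - p)) has_real_derivative w t * slope p t) (at t)"
proof -
  define q where "q s = (\<gamma> s $ 1 - p $ 1)\<^sup>2 + (\<gamma> s $ 2 - p $ 2)\<^sup>2" for s
  have norm_q: "norm (\<gamma> s - p) = sqrt (q s)" for s
    by (simp add: q_def norm_eq_sqrt_inner inner_real2 power2_eq_square)
  have "norm (\<gamma> t - p) > 0"
    using assms by simp
  then have pos: "q t > 0"
    by (simp add: norm_q)
  have "(q has_real_derivative 2 * w t * inner (\<gamma> t - p) (dir (\<theta> t))) (at t)"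
    unfolding q_def
    by (rule derivative_eq_intros component_deriv refl)+
      (simp add: inner_real2 dir_def algebra_simps)
  from DERIV_chain2[OF DERIV_real_sqrt[OF pos] this]
  have "((\<lambda>s. sqrt (q s)) has_real_derivative
      inverse (sqrt (q t)) / 2 * (2 * w t * inner (\<gamma> t - p) (dir (\<theta> t)))) (at t)" .
  moreover have "inverse (sqrt (q t)) / 2 * (2 * w t * inner (\<gamma> t - p) (dir (\<theta> t))) = w t * slope p t"
    using pos by (simp add: slope_def norm_q field_simps)
  ultimately show ?thesis
    by (simp only: norm_q)
qed

text \<open>The distance \<open>d\<close> to a point of the curve is strictly concave in arclength. With \<open>n < 0\<close> the component of
  \<open>\<gamma> t - \<gamma> u\<close> along the inner normal, its second arclength derivative is \<open>n * (\<kappa> t * d\<^sup>2 + n) / d ^ 3\<close>.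
  The tangent disc of radius \<open>1 / K\<close> gives \<open>- 2 * n \<le> K * d\<^sup>2\<close>, and \<open>K < 2 * \<kappa> t\<close>
  turns this into positivity of the second factor.\<close>
lemma slope_deriv:
  assumes ne: "\<gamma> t \<noteq> \<gamma> u"
  shows "\<exists>D<0. (slope (\<gamma> u) has_real_derivative D) (at t)"
proof -
  obtain u' where u': "\<gamma> u' = \<gamma> u" "\<bar>\<theta> u' - \<theta> t\<bar> \<le> pi"
    by (rule nearby_parameter)
  define r where "r = \<gamma> t - \<gamma> u"
  define d where "d = norm r"
  define N where "N = inner r (dir (\<theta> t))"
  define n where "n = inner r (dir (\<theta> t + pi/2))"
  have d: "d > 0" using ne by (simp add: d_def r_def)
  have "u' \<noteq> t" using ne u' by auto
  then have n_neg: "n < 0"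
    using strictly_left[of u' t] u' by (simp add: n_def r_def inner_diff_left)
  have "- 2 * n \<le> K * d\<^sup>2"
    using outside_tangent_disc[of u' t] u'
    by (simp add: n_def r_def d_def inner_diff_left norm_minus_commute)
  also have "\<dots> < 2 * \<kappa> t * d\<^sup>2"
    using pinched[of t] d by simp
  finally have pos: "\<kappa> t * d\<^sup>2 + n > 0" by simp
  have pyth: "N\<^sup>2 + n\<^sup>2 = d\<^sup>2"
    unfolding N_def n_def d_def by (rule pythagoras_dir)
  have "((\<lambda>s. inner (\<gamma> s - \<gamma> u) (dir (\<theta> s))) has_real_derivative w t * (\<kappa> t * n + 1)) (at t)"
  proof -
    have "((\<lambda>s. inner (\<gamma> s - \<gamma> u) (dir (\<theta> s))) has_real_derivative
        w t * (cos (\<theta> t))\<^sup>2 + w t * (sin (\<theta> t))\<^sup>2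
        + \<kappa> t * w t * (r $ 2 * cos (\<theta> t) - r $ 1 * sin (\<theta> t))) (at t)"
      unfolding inner_real2 dir_def vector_2 vector_minus_component r_def
      by (rule derivative_eq_intros component_deriv theta_deriv refl)+
        (simp add: algebra_simps power2_eq_square)
    moreover have "n = r $ 2 * cos (\<theta> t) - r $ 1 * sin (\<theta> t)"
      by (simp add: n_def inner_real2 dir_def cos_add sin_add)
    moreover have "w t * (\<kappa> t * n + 1) = w t * (cos (\<theta> t))\<^sup>2 + w t * (sin (\<theta> t))\<^sup>2 + \<kappa> t * w t * n"
      using sin_cos_squared_add2[of "\<theta> t"] by algebra
    ultimately show ?thesis
      by (simp only:)
  qed
  then have "(slope (\<gamma> u) has_real_derivative
      (w t * (\<kappa> t * n + 1) * d - N * (w t * slope (\<gamma> u) t)) / (d * d)) (at t)"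
    unfolding slope_def N_def d_def r_def
    using DERIV_divide[OF _ norm_deriv[OF ne]] ne by (simp add: slope_def)
  moreover have "(w t * (\<kappa> t * n + 1) * d - N * (w t * slope (\<gamma> u) t)) / (d * d)
      = w t * (n * (\<kappa> t * d\<^sup>2 + n)) / d ^ 3"
  proof -
    have "(w t * (\<kappa> t * n + 1) * d - N * (w t * slope (\<gamma> u) t)) / (d * d)
        = w t * (\<kappa> t * n * d\<^sup>2 + d\<^sup>2 - N\<^sup>2) / d ^ 3"
      using d by (simp add: slope_def N_def[symmetric] d_def[symmetric] r_def[symmetric]
          field_simps power2_eq_square power3_eq_cube)
    also have "\<kappa> t * n * d\<^sup>2 + d\<^sup>2 - N\<^sup>2 = n * (\<kappa> t * d\<^sup>2 + n)"
      using pyth by (simp add: algebra_simps power2_eq_square)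
    finally show ?thesis .
  qed
  moreover have "w t * (n * (\<kappa> t * d\<^sup>2 + n)) / d ^ 3 < 0"
    using n_neg pos d speed_pos[of t]
    by (intro divide_neg_pos mult_pos_neg mult_neg_pos) auto
  ultimately show ?thesis by auto
qed

lemma potential_cont: "isCont (\<lambda>s. \<Sum>j\<in>J. m j * norm (\<gamma> s - \<gamma> j)) t"
  by (intro continuous_intros gamma_cont)

text \<open>Off the support, the potential is a positive combination of distances that are strictly concave in
  arclength near \<open>t\<close>. Its arclength derivative \<open>\<psi>\<close> is therefore strictly decreasing at \<open>t\<close>, so \<open>t\<close> cannot be
  a critical point that is a minimum.\<close>
lemma not_minimal_off_support:
  assumes fin: "finite J" "J \<noteq> {}" and pos: "\<And>j. j \<in> J \<Longrightarrow> m j > 0"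
    and off: "\<And>j. j \<in> J \<Longrightarrow> \<gamma> t \<noteq> \<gamma> j"
  shows "\<exists>s. (\<Sum>j\<in>J. m j * norm (\<gamma> s - \<gamma> j)) < (\<Sum>j\<in>J. m j * norm (\<gamma> t - \<gamma> j))"
proof (rule ccontr)
  define \<phi> where "\<phi> s = (\<Sum>j\<in>J. m j * norm (\<gamma> s - \<gamma> j))" for s
  define \<psi> where "\<psi> s = (\<Sum>j\<in>J. m j * slope (\<gamma> j) s)" for s
  assume "\<nexists>s. (\<Sum>j\<in>J. m j * norm (\<gamma> s - \<gamma> j)) < (\<Sum>j\<in>J. m j * norm (\<gamma> t - \<gamma> j))"
  then have min: "\<phi> t \<le> \<phi> s" for s
    by (simp add: \<phi>_def not_less)
  have \<phi>': "(\<phi> has_real_derivative w s * \<psi> s) (at s)" if "\<And>j. j \<in> J \<Longrightarrow> \<gamma> s \<noteq> \<gamma> j" for s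
  proof -
    have "(\<phi> has_real_derivative (\<Sum>j\<in>J. m j * (w s * slope (\<gamma> j) s))) (at s)"
      unfolding \<phi>_def using that by (intro DERIV_sum DERIV_cmult norm_deriv) auto
    then show ?thesis
      by (simp add: \<psi>_def sum_distrib_left mult_ac)
  qed
  have "w t * \<psi> t = 0"
    by (rule DERIV_local_min[OF \<phi>'[OF off] zero_less_one]) (use min in auto)
  then have \<psi>0: "\<psi> t = 0" using speed_pos[of t] by simp
  obtain D where D: "\<And>j. j \<in> J \<Longrightarrow> D j < 0"
      "\<And>j. j \<in> J \<Longrightarrow> (slope (\<gamma> j) has_real_derivative D j) (at t)"
    using slope_deriv off by metis
  have "(\<psi> has_real_derivative (\<Sum>j\<in>J. m j * D j)) (at t)"
    unfolding \<psi>_def using D by (intro DERIV_sum DERIV_cmult) auto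
  moreover have "(\<Sum>j\<in>J. m j * D j) < 0"
    using sum_strict_mono[of J "\<lambda>j. m j * D j" "\<lambda>_. 0"] fin pos D by (simp add: mult_pos_neg)
  ultimately obtain \<delta> where \<delta>: "\<delta> > 0" "\<And>h. 0 < h \<Longrightarrow> h < \<delta> \<Longrightarrow> \<psi> (t + h) < 0"
    using DERIV_neg_dec_right[of \<psi> _ t] \<psi>0 by metis
  have "\<forall>\<^sub>F s in at t. \<forall>j\<in>J. \<gamma> s \<noteq> \<gamma> j"
    using gamma_cont[of t] off fin(1)
    by (intro eventually_ball_finite) (auto simp: isCont_def intro: tendsto_imp_eventually_ne)
  then obtain e where e: "e > 0" "\<And>s j. s \<noteq> t \<Longrightarrow> dist s t < e \<Longrightarrow> j \<in> J \<Longrightarrow> \<gamma> s \<noteq> \<gamma> j"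
    unfolding eventually_at by blast
  define h where "h = min \<delta> e / 2"
  have h: "0 < h" "h < \<delta>" "h < e" using \<delta>(1) e(1) by (auto simp: h_def)
  have "\<phi> (t + h) < \<phi> t"
  proof (rule DERIV_neg_imp_decreasing_open[of t "t + h" \<phi>])
    fix s assume s: "t < s" "s < t + h"
    then have "(\<phi> has_real_derivative w s * \<psi> s) (at s)"
      using h e(2)[of s] by (intro \<phi>') (auto simp: dist_real_def)
    moreover have "w s * \<psi> s < 0"
      using \<delta>(2)[of "s - t"] s h speed_pos[of s] by (simp add: mult_pos_neg)
    ultimately show "\<exists>y. (\<phi> has_real_derivative y) (at s) \<and> y < 0" by blast
  next
    show "continuous_on {t..t + h} \<phi>"
      unfolding \<phi>_def by (intro continuous_at_imp_continuous_on ballI potential_cont)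
  qed (use h in auto)
  then show False using min[of "t + h"] by simp
qed

text \<open>Energy-maximizing weights work. A global minimum of their potential over the whole curve exists by
  periodicity and lies on the support; by the first-order condition the potential on the support
  is the maximum over \<open>A\<close>. Both bounds pinch the potential on \<open>A\<close>.\<close>
lemma equalizing_weights:
  assumes fin: "finite A" "A \<noteq> {}"
  obtains m where "\<And>a. m a \<ge> 0" "(\<Sum>a\<in>A. m a) = (1::real)"
    "\<And>a b. a \<in> A \<Longrightarrow> b \<in> A \<Longrightarrow>
       (\<Sum>c\<in>A. m c * norm (\<gamma> a - \<gamma> c)) = (\<Sum>c\<in>A. m c * norm (\<gamma> b - \<gamma> c))"
proof -
  obtain m where m: "\<And>a. m a \<ge> 0" "(\<Sum>a\<in>A. m a) = (1::real)"
    and max: "\<And>a b. \<lbrakk>a \<in> A; b \<in> A; m a > 0\<rbrakk> \<Longrightarrow>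
       (\<Sum>c\<in>A. m c * norm (\<gamma> b - \<gamma> c)) \<le> (\<Sum>c\<in>A. m c * norm (\<gamma> a - \<gamma> c))"
    by (rule energy_maximizer[OF fin, of "\<lambda>a b. norm (\<gamma> a - \<gamma> b)"])
      (auto simp: norm_minus_commute)
  define \<phi> where "\<phi> s = (\<Sum>c\<in>A. m c * norm (\<gamma> s - \<gamma> c))" for s
  define J where "J = {a \<in> A. m a > 0}"
  have "J \<noteq> {}"
  proof
    assume "J = {}"
    then have "m a = 0" if "a \<in> A" for a
      using that m(1)[of a] by (force simp: J_def)
    then show False using m(2) by simp
  qed
  have \<phi>_J: "\<phi> s = (\<Sum>j\<in>J. m j * norm (\<gamma> s - \<gamma> j))" for s
    unfolding \<phi>_def J_def using fin m(1)
    by (intro sum.mono_neutral_right) (auto simp: not_less intro: antisym)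
  have "continuous_on {0..1} \<phi>"
    unfolding \<phi>_def by (intro continuous_at_imp_continuous_on ballI potential_cont)
  then obtain t where t: "\<forall>s\<in>{0..1}. \<phi> t \<le> \<phi> s"
    using continuous_attains_inf[of "{0..1::real}" \<phi>] by fastforce
  have min: "\<phi> t \<le> \<phi> s" for s
  proof -
    have "\<phi> t \<le> \<phi> (frac s)"
      using t frac_lt_1[of s] by (simp add: less_imp_le)
    then show ?thesis
      by (simp add: \<phi>_def gamma_frac)
  qed
  have "\<exists>j\<in>J. \<gamma> t = \<gamma> j"
  proof (rule ccontr)
    assume "\<not> (\<exists>j\<in>J. \<gamma> t = \<gamma> j)"
    moreover have "finite J" "\<And>j. j \<in> J \<Longrightarrow> m j > 0"
      using fin by (simp_all add: J_def)
    ultimately have "\<exists>s. \<phi> s < \<phi> t"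
      unfolding \<phi>_J using \<open>J \<noteq> {}\<close> by (intro not_minimal_off_support) auto
    then show False
      using min by (meson not_less)
  qed
  then obtain j where j: "j \<in> J" "\<gamma> t = \<gamma> j" by blast
  have "\<phi> a = \<phi> t" if "a \<in> A" for a
    using max[of j a] min[of a] that j by (intro antisym) (auto simp: \<phi>_def J_def)
  then have "\<phi> a = \<phi> b" if "a \<in> A" "b \<in> A" for a b
    using that by metis
  then show thesis
    unfolding \<phi>_def by (rule that[OF m])
qed

end

section \<open>The weak limit\<close>

text \<open>The interval leaves a margin to the left of 0 because tightness is measured on left-open intervals.\<close>
lemma weighted_points_distribution:
  fixes m :: "real \<Rightarrow> real"
  assumes fin: "finite A" and sub: "A \<subseteq> {0..1}"
    and nonneg: "\<And>a. m a \<ge> 0" and one: "(\<Sum>a\<in>A. m a) = 1"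
  obtains M where "real_distribution M" "measure M {-1<..2} = 1"
    "\<And>f. f \<in> borel_measurable borel \<Longrightarrow> (\<integral>t. f t \<partial>M) = (\<Sum>a\<in>A. m a * (f a :: real))"
proof -
  define g where "g a = (if a \<in> A then m a else 0)" for a
  have "(\<integral>\<^sup>+ x. ennreal (g x) \<partial>count_space UNIV) = (\<Sum>x\<in>A. ennreal (g x))"
    using fin by (intro nn_integral_count_space') (auto simp: g_def)
  also have "\<dots> = ennreal (\<Sum>a\<in>A. m a)"
    using nonneg by (simp add: g_def)
  finally have "(\<integral>\<^sup>+ x. ennreal (g x) \<partial>count_space UNIV) = 1"
    using one by simp
  moreover have "g a \<ge> 0" for a
    using nonneg by (simp add: g_def)
  ultimately have P: "pmf (embed_pmf g) a = g a" "set_pmf (embed_pmf g) = {a. g a \<noteq> 0}" for a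
    by (simp_all add: pmf_embed_pmf set_embed_pmf)
  define M where "M = distr (measure_pmf (embed_pmf g)) borel (\<lambda>x. x)"
  have "real_distribution M"
    unfolding M_def by (intro prob_space.real_distribution_distr measure_pmf.prob_space_axioms) simp
  moreover have "measure M {-1<..2} = 1"
  proof -
    have "AE x in embed_pmf g. x \<in> {-1<..2}"
      using sub by (auto simp: AE_measure_pmf_iff P g_def split: if_splits)
    then have "measure (embed_pmf g) {-1<..2} = 1"
      by (simp add: measure_pmf.prob_eq_1)
    then show ?thesis
      unfolding M_def by (simp add: measure_distr)
  qed
  moreover have "(\<integral>t. f t \<partial>M) = (\<Sum>a\<in>A. m a * (f a :: real))" if "f \<in> borel_measurable borel" for f
  proof -
    have "(\<integral>t. f t \<partial>M) = (\<integral>t. f t \<partial>embed_pmf g)"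
      unfolding M_def using that by (intro integral_distr) auto
    also have "\<dots> = (\<Sum>a\<in>A. f a * pmf (embed_pmf g) a)"
      by (rule integral_measure_pmf_real[OF fin]) (auto simp: P g_def split: if_splits)
    also have "\<dots> = (\<Sum>a\<in>A. m a * f a)"
      by (intro sum.cong) (auto simp: P g_def)
    finally show ?thesis .
  qed
  ultimately show thesis using that by blast
qed

definition grid :: "nat \<Rightarrow> real set" where
  "grid n = (\<lambda>i. real i / real (Suc n)) ` {..n}"

lemma grid_approx:
  assumes "0 \<le> s" "s < 1"
  obtains a where "\<And>n. a n \<in> grid n" "a \<longlonglongrightarrow> s"
proof
  define k where "k n = nat \<lfloor>s * real (Suc n)\<rfloor>" for n
  have k: "real (k n) \<le> s * real (Suc n)" "s * real (Suc n) < real (k n) + 1" for n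
    using assms(1) unfolding k_def by (simp_all add: of_nat_nat)
  show "real (k n) / real (Suc n) \<in> grid n" for n
  proof -
    have "s * real (Suc n) < 1 * real (Suc n)"
      using assms(2) by (intro mult_strict_right_mono) auto
    then have "real (k n) < real (Suc n)"
      using le_less_trans[OF k(1)[of n]] by (simp only: mult_1_left)
    then show ?thesis
      by (auto simp: grid_def)
  qed
  show "(\<lambda>n. real (k n) / real (Suc n)) \<longlonglongrightarrow> s"
  proof (rule tendsto_sandwich)
    have "s \<le> (real (k n) + 1) / real (Suc n)" for n
      by (subst pos_le_divide_eq) (use k(2)[of n] in linarith)+
    then show "\<forall>\<^sub>F n in sequentially. s - 1 / real (Suc n) \<le> real (k n) / real (Suc n)"
      by (intro always_eventually allI) (simp add: add_divide_distrib diff_le_eq del: of_nat_Suc)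
    show "\<forall>\<^sub>F n in sequentially. real (k n) / real (Suc n) \<le> s"
      using k(1) by (intro always_eventually allI) (simp add: pos_divide_le_eq)
    show "(\<lambda>n. s - 1 / real (Suc n)) \<longlonglongrightarrow> s"
      using tendsto_diff[OF tendsto_const LIMSEQ_inverse_real_of_nat, of s]
      by (simp add: inverse_eq_divide)
  qed auto
qed

context turning_curve begin

lemma norm_bound: obtains B where "\<And>s t. norm (norm (\<gamma> s - \<gamma> t)) \<le> B"
proof -
  have "bounded (\<gamma> ` {0..1})"
    by (intro compact_imp_bounded compact_continuous_image continuous_at_imp_continuous_on)
      (auto intro: gamma_cont)
  then obtain B where B: "\<And>t. t \<in> {0..1} \<Longrightarrow> norm (\<gamma> t) \<le> B"
    unfolding bounded_iff by blast
  have B': "norm (\<gamma> t) \<le> B" for t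
    using B[of "frac t"] frac_lt_1[of t] by (simp add: gamma_frac less_imp_le)
  have "norm (norm (\<gamma> s - \<gamma> t)) \<le> B + B" for s t
    using norm_triangle_ineq4[of "\<gamma> s" "\<gamma> t"] B'[of s] B'[of t] by simp
  then show thesis by (rule that)
qed

lemma kernel_cont: "isCont (\<lambda>t. norm (\<gamma> s - \<gamma> t)) t"
  by (intro continuous_intros gamma_cont)

lemma kernel_measurable: "(\<lambda>t. norm (\<gamma> s - \<gamma> t)) \<in> borel_measurable borel"
  by (intro borel_measurable_continuous_onI continuous_at_imp_continuous_on ballI kernel_cont)

lemma kernel_integrable:
  assumes "real_distribution M"
  shows "integrable M (\<lambda>t. norm (\<gamma> s - \<gamma> t))"
proof -
  interpret real_distribution M by fact
  obtain B where "\<And>s t. norm (norm (\<gamma> s - \<gamma> t)) \<le> B"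
    using norm_bound by blast
  then show ?thesis
    using kernel_measurable by (intro integrable_const_bound[where B = B]) auto
qed

lemma potential_lipschitz:
  assumes "real_distribution M"
  shows "\<bar>(\<integral>t. norm (\<gamma> s - \<gamma> t) \<partial>M) - (\<integral>t. norm (\<gamma> s' - \<gamma> t) \<partial>M)\<bar> \<le> norm (\<gamma> s - \<gamma> s')"
proof -
  interpret real_distribution M by fact
  have le: "(\<integral>t. norm (\<gamma> s - \<gamma> t) \<partial>M) \<le> norm (\<gamma> s - \<gamma> s') + (\<integral>t. norm (\<gamma> s' - \<gamma> t) \<partial>M)" for s s'
  proof -
    have "(\<integral>t. norm (\<gamma> s - \<gamma> t) \<partial>M) \<le> (\<integral>t. norm (\<gamma> s - \<gamma> s') + norm (\<gamma> s' - \<gamma> t) \<partial>M)"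
      using kernel_integrable[OF assms] norm_triangle_ineq[of "\<gamma> s - \<gamma> s'" "\<gamma> s' - \<gamma> _"]
      by (intro integral_mono) auto
    also have "\<dots> = norm (\<gamma> s - \<gamma> s') + (\<integral>t. norm (\<gamma> s' - \<gamma> t) \<partial>M)"
      using kernel_integrable[OF assms] prob_space by (subst Bochner_Integration.integral_add) auto
    finally show ?thesis .
  qed
  show ?thesis
    using le[of s s'] le[of s' s] by (simp add: norm_minus_commute abs_le_iff)
qed

text \<open>Measures on the parameter line are used because Helly's selection theorem applies there. The potentials
  of the measures on the grids converge pointwise along a subsequence. Each of them is constant on
  its grid and 1-Lipschitz along the curve, and the grids become dense, so the limit is constant.\<close>
lemma equalizing_distribution:
  obtains M where "real_distribution M"
    "\<And>s s'. (\<integral>t. norm (\<gamma> s - \<gamma> t) \<partial>M) = (\<integral>t. norm (\<gamma> s' - \<gamma> t) \<partial>M)"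
proof -
  have "\<exists>M. real_distribution M \<and> measure M {-1<..2} = 1 \<and>
      (\<forall>a\<in>grid n. \<forall>b\<in>grid n. (\<integral>t. norm (\<gamma> a - \<gamma> t) \<partial>M) = (\<integral>t. norm (\<gamma> b - \<gamma> t) \<partial>M))" for n
  proof -
    have fin: "finite (grid n)" "grid n \<noteq> {}" and sub: "grid n \<subseteq> {0..1}"
      by (auto simp: grid_def)
    obtain m where m: "\<And>a. m a \<ge> 0" "(\<Sum>a\<in>grid n. m a) = (1::real)"
      "\<And>a b. a \<in> grid n \<Longrightarrow> b \<in> grid n \<Longrightarrow>
         (\<Sum>c\<in>grid n. m c * norm (\<gamma> a - \<gamma> c)) = (\<Sum>c\<in>grid n. m c * norm (\<gamma> b - \<gamma> c))"
      by (rule equalizing_weights[OF fin]) (rule that)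
    obtain M where M: "real_distribution M" "measure M {-1<..2} = 1"
      "\<And>f. f \<in> borel_measurable borel \<Longrightarrow> (\<integral>t. f t \<partial>M) = (\<Sum>a\<in>grid n. m a * (f a :: real))"
      using weighted_points_distribution[OF fin(1) sub, of m] m(1,2) by blast
    show ?thesis
    proof (intro exI[of _ M] conjI ballI)
      fix a b assume "a \<in> grid n" "b \<in> grid n"
      then show "(\<integral>t. norm (\<gamma> a - \<gamma> t) \<partial>M) = (\<integral>t. norm (\<gamma> b - \<gamma> t) \<partial>M)"
        using m(3)[of a b] by (simp add: M(3)[OF kernel_measurable])
    qed (fact M(1) M(2))+
  qed
  then obtain \<mu> where \<mu>: "\<And>n. real_distribution (\<mu> n)" "\<And>n. measure (\<mu> n) {-1<..2} = 1"
    "\<And>n a b. a \<in> grid n \<Longrightarrow> b \<in> grid n \<Longrightarrow>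
       (\<integral>t. norm (\<gamma> a - \<gamma> t) \<partial>\<mu> n) = (\<integral>t. norm (\<gamma> b - \<gamma> t) \<partial>\<mu> n)"
    by metis
  have "tight \<mu>"
    unfolding tight_def
  proof (intro conjI allI impI exI)
    show "(- 1 :: real) < 2" by simp
  qed (use \<mu> in auto)
  then obtain r M where r: "strict_mono r" and M: "real_distribution M"
    and weak: "weak_conv_m (\<mu> \<circ> id \<circ> r) M"
    using tight_imp_convergent_subsubsequence[of \<mu> id] by (auto simp: strict_mono_id)
  obtain B where B: "\<And>s t. norm (norm (\<gamma> s - \<gamma> t)) \<le> B"
    using norm_bound by blast
  have lim: "(\<lambda>n. \<integral>t. norm (\<gamma> s - \<gamma> t) \<partial>\<mu> (r n)) \<longlonglongrightarrow> (\<integral>t. norm (\<gamma> s - \<gamma> t) \<partial>M)" for s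
    using weak_conv_imp_integral_bdd_continuous_conv[OF _ M weak kernel_cont B] \<mu>(1) by simp
  have eq: "(\<integral>t. norm (\<gamma> s - \<gamma> t) \<partial>M) = (\<integral>t. norm (\<gamma> s' - \<gamma> t) \<partial>M)"
    if s: "0 \<le> s" "s < 1" and s': "0 \<le> s'" "s' < 1" for s s'
  proof -
    obtain a a' where a: "\<And>n. a n \<in> grid n" "a \<longlonglongrightarrow> s" and a': "\<And>n. a' n \<in> grid n" "a' \<longlonglongrightarrow> s'"
      using grid_approx[OF s] grid_approx[OF s'] by metis
    \<comment> \<open>Bounds the oscillation of the \<open>n\<close>-th potential between \<open>s\<close> and \<open>s'\<close> by passing through the grid points.\<close>
    define e where "e n = norm (\<gamma> s - \<gamma> (a n)) + norm (\<gamma> s' - \<gamma> (a' n))" for n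
    have "e \<longlonglongrightarrow> norm (\<gamma> s - \<gamma> s) + norm (\<gamma> s' - \<gamma> s')"
      unfolding e_def by (intro tendsto_intros isCont_tendsto_compose[OF gamma_cont] a a')
    then have e0: "(\<lambda>n. e (r n)) \<longlonglongrightarrow> 0"
      using LIMSEQ_subseq_LIMSEQ[OF _ r] by (fastforce simp: o_def)
    have le: "\<bar>(\<integral>t. norm (\<gamma> s - \<gamma> t) \<partial>\<mu> n) - (\<integral>t. norm (\<gamma> s' - \<gamma> t) \<partial>\<mu> n)\<bar> \<le> e n" for n
      using potential_lipschitz[OF \<mu>(1)[of n], of s "a n"] potential_lipschitz[OF \<mu>(1)[of n], of s' "a' n"]
        \<mu>(3)[OF a(1) a'(1), of n] unfolding e_def by linarith
    have "(\<lambda>n. (\<integral>t. norm (\<gamma> s - \<gamma> t) \<partial>\<mu> (r n)) - (\<integral>t. norm (\<gamma> s' - \<gamma> t) \<partial>\<mu> (r n))) \<longlonglongrightarrow> 0"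
      by (rule Lim_null_comparison[OF _ e0], unfold real_norm_def) (intro always_eventually allI le)
    from LIMSEQ_unique[OF tendsto_diff[OF lim[of s] lim[of s']] this] show ?thesis
      by simp
  qed
  show thesis
  proof (rule that[OF M])
    show "(\<integral>t. norm (\<gamma> s - \<gamma> t) \<partial>M) = (\<integral>t. norm (\<gamma> s' - \<gamma> t) \<partial>M)" for s s'
    proof -
      have "(\<integral>t. norm (\<gamma> (frac s) - \<gamma> t) \<partial>M) = (\<integral>t. norm (\<gamma> (frac s') - \<gamma> t) \<partial>M)"
        by (rule eq) (simp_all add: frac_lt_1)
      then show ?thesis
        unfolding gamma_frac .
    qed
  qed
qed

text \<open>The measure on the parameter line becomes one on the curve by pushing it forward along \<open>\<gamma>\<close>,
  which maps the whole line to the curve.\<close>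
lemma equalizing_measure:
  obtains \<mu> :: "(real^2) measure" where
    "prob_space \<mu>" "sets \<mu> = sets (restrict_space borel (range \<gamma>))"
    "(\<lambda>x. \<integral>y. norm (x - y) \<partial>\<mu>) constant_on (range \<gamma>)"
proof -
  obtain M where "real_distribution M"
    and eq: "\<And>s s'. (\<integral>t. norm (\<gamma> s - \<gamma> t) \<partial>M) = (\<integral>t. norm (\<gamma> s' - \<gamma> t) \<partial>M)"
    by (rule equalizing_distribution) (rule that)
  then interpret real_distribution M by simp
  have "\<gamma> \<in> borel_measurable borel"
    by (intro borel_measurable_continuous_onI continuous_at_imp_continuous_on ballI gamma_cont)
  then have meas: "\<gamma> \<in> measurable M (restrict_space borel (range \<gamma>))"
    by (intro measurable_restrict_space2) auto
  define \<mu> where "\<mu> = distr M (restrict_space borel (range \<gamma>)) \<gamma>"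
  have pushforward: "(\<integral>y. norm (x - y) \<partial>\<mu>) = (\<integral>t. norm (x - \<gamma> t) \<partial>M)" for x
    unfolding \<mu>_def
    by (rule integral_distr[OF meas]) (intro measurable_restrict_space1, measurable)
  have "(\<lambda>x. \<integral>y. norm (x - y) \<partial>\<mu>) constant_on (range \<gamma>)"
    unfolding constant_on_def
  proof (intro exI ballI)
    fix x assume "x \<in> range \<gamma>"
    then obtain s where "x = \<gamma> s" by blast
    then show "(\<integral>y. norm (x - y) \<partial>\<mu>) = (\<integral>t. norm (\<gamma> 0 - \<gamma> t) \<partial>M)"
      unfolding pushforward using eq[of s 0] by (simp only:)
  qed
  then show thesis
    using that[of \<mu>] prob_space_distr[OF meas] by (simp add: \<mu>_def)
qed

end

section \<open>From curvature bounds to total turning\<close>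

lemma velocity_periodic:
  assumes diff: "\<And>t. (\<gamma> has_vector_derivative velocity \<gamma> t) (at t)"
    and per: "\<And>t. \<gamma> (t + 1) = \<gamma> t"
  shows "velocity \<gamma> (t + 1) = velocity \<gamma> t"
proof -
  have "((\<lambda>s. s + 1) has_vector_derivative 1) (at t)"
    by (auto intro!: derivative_eq_intros)
  from vector_diff_chain_at[OF this diff]
  have "((\<lambda>s. \<gamma> (s + 1)) has_vector_derivative velocity \<gamma> (t + 1)) (at t)"
    by (simp add: o_def)
  then have "(\<gamma> has_vector_derivative velocity \<gamma> (t + 1)) (at t)"
    by (simp only: per)
  from vector_derivative_unique_at[OF this diff] show ?thesis .
qed

text \<open>A nonvanishing planar vector field has a differentiable angle. An antiderivative \<open>\<theta>\<close> of the formal angular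
  velocity is the angle, because the cosine \<open>f\<close> of the angle between the field and \<open>(cos \<theta>, sin \<theta>)\<close>
  is constant, and equal to 1 at parameter 0.\<close>
lemma angle_function:
  fixes v1 v2 a1 a2 :: "real \<Rightarrow> real"
  assumes v1': "\<And>t. (v1 has_real_derivative a1 t) (at t)"
    and v2': "\<And>t. (v2 has_real_derivative a2 t) (at t)"
    and cont: "continuous_on UNIV a1" "continuous_on UNIV a2"
    and ne: "\<And>t. (v1 t)\<^sup>2 + (v2 t)\<^sup>2 > 0"
  obtains \<theta> where
    "\<And>t. (\<theta> has_real_derivative (v1 t * a2 t - v2 t * a1 t) / ((v1 t)\<^sup>2 + (v2 t)\<^sup>2)) (at t)"
    "\<And>t. v1 t = sqrt ((v1 t)\<^sup>2 + (v2 t)\<^sup>2) * cos (\<theta> t)"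
    "\<And>t. v2 t = sqrt ((v1 t)\<^sup>2 + (v2 t)\<^sup>2) * sin (\<theta> t)"
proof -
  define q where "q t = (v1 t)\<^sup>2 + (v2 t)\<^sup>2" for t
  define w where "w t = sqrt (q t)" for t
  have q: "q t > 0" and w: "w t > 0" and ww: "w t * w t = q t" for t
    using ne[of t] by (simp_all add: q_def w_def)
  have cont_v: "continuous_on UNIV v1" "continuous_on UNIV v2"
    using v1' v2' by (meson DERIV_isCont continuous_at_imp_continuous_on)+
  define g where "g t = (v1 t * a2 t - v2 t * a1 t) / q t" for t
  have "q t \<noteq> 0" for t using q[of t] by simp
  then have "continuous_on UNIV g"
    unfolding g_def q_def by (intro continuous_intros cont cont_v) auto
  then have "isCont g t" for t
    by (simp add: continuous_on_eq_continuous_at)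
  then obtain F where F: "\<And>t. (F has_vector_derivative g t) (at t)"
    using einterval_antiderivative[of "-\<infinity>" "\<infinity>" g] by auto
  have "(v1 0 / w 0)\<^sup>2 + (v2 0 / w 0)\<^sup>2 = q 0 / (w 0 * w 0)"
    by (simp add: power_divide q_def add_divide_distrib power2_eq_square)
  then have "(v1 0 / w 0)\<^sup>2 + (v2 0 / w 0)\<^sup>2 = 1"
    using q[of 0] by (simp add: ww)
  then obtain \<alpha> where \<alpha>: "v1 0 / w 0 = cos \<alpha>" "v2 0 / w 0 = sin \<alpha>"
    using sincos_total_2pi_le by blast
  define \<theta> where "\<theta> t = F t - F 0 + \<alpha>" for t
  have \<theta>': "(\<theta> has_real_derivative g t) (at t)" for t
    using F[of t] unfolding \<theta>_def
    by (auto intro!: derivative_eq_intros simp: has_real_derivative_iff_has_vector_derivative)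
  have w': "(w has_real_derivative (v1 t * a1 t + v2 t * a2 t) / w t) (at t)" for t
  proof -
    have "(q has_real_derivative 2 * (v1 t * a1 t + v2 t * a2 t)) (at t)"
      unfolding q_def by (rule derivative_eq_intros v1' v2' refl)+ (simp add: algebra_simps)
    from DERIV_chain2[OF DERIV_real_sqrt[OF q[of t]] this]
    have "((\<lambda>t. sqrt (q t)) has_real_derivative
        inverse (sqrt (q t)) / 2 * (2 * (v1 t * a1 t + v2 t * a2 t))) (at t)" .
    moreover have "inverse (sqrt (q t)) / 2 * (2 * (v1 t * a1 t + v2 t * a2 t))
        = (v1 t * a1 t + v2 t * a2 t) / sqrt (q t)"
      using q[of t] by (simp add: field_simps)
    ultimately show ?thesis
      unfolding w_def by (simp only:)
  qed
  define f where "f t = (v1 t * cos (\<theta> t) + v2 t * sin (\<theta> t)) / w t" for t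
  have f': "(f has_real_derivative 0) (at t)" for t
  proof -
    define p where "p = v1 t * a1 t + v2 t * a2 t"
    have "((\<lambda>t. v1 t * cos (\<theta> t) + v2 t * sin (\<theta> t)) has_real_derivative
        a1 t * cos (\<theta> t) + a2 t * sin (\<theta> t) + g t * (v2 t * cos (\<theta> t) - v1 t * sin (\<theta> t))) (at t)"
      by (rule derivative_eq_intros v1' v2' \<theta>' refl)+ (simp add: algebra_simps)
    from DERIV_divide[OF this w'[of t]]
    have "(f has_real_derivative
        ((a1 t * cos (\<theta> t) + a2 t * sin (\<theta> t) + g t * (v2 t * cos (\<theta> t) - v1 t * sin (\<theta> t))) * w t
          - (v1 t * cos (\<theta> t) + v2 t * sin (\<theta> t)) * (p / w t)) / (w t * w t)) (at t)"
      using w[of t] unfolding f_def p_def by simp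
    moreover have "(a1 t * cos (\<theta> t) + a2 t * sin (\<theta> t) + g t * (v2 t * cos (\<theta> t) - v1 t * sin (\<theta> t))) * w t
          - (v1 t * cos (\<theta> t) + v2 t * sin (\<theta> t)) * (p / w t) = 0" (is "?A * w t - ?B * (p / w t) = 0")
    proof -
      have "g t * q t = v1 t * a2 t - v2 t * a1 t"
        using q[of t] by (simp add: g_def)
      then have "?A * q t = ?B * p"
        unfolding p_def q_def by algebra
      then have "(?A * w t - ?B * (p / w t)) * w t = 0"
        using w[of t] ww[of t] by (simp add: left_diff_distrib mult.assoc)
      then show ?thesis
        using w[of t] by simp
    qed
    ultimately show ?thesis by simp
  qed
  have f1: "f t = 1" for t
  proof -
    have "f t = f 0"
      using DERIV_isconst_all f' by blast
    also have "f 0 = v1 0 / w 0 * cos \<alpha> + v2 0 / w 0 * sin \<alpha>"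
      by (simp add: f_def \<theta>_def add_divide_distrib)
    also have "\<dots> = 1"
      unfolding \<alpha> by (simp flip: power2_eq_square)
    finally show ?thesis .
  qed
  have "(v1 t - w t * cos (\<theta> t))\<^sup>2 + (v2 t - w t * sin (\<theta> t))\<^sup>2 = 0" for t
  proof -
    have "v1 t * cos (\<theta> t) + v2 t * sin (\<theta> t) = w t"
      using f1[of t] w[of t] by (simp add: f_def)
    moreover have "(v1 t - w t * cos (\<theta> t))\<^sup>2 + (v2 t - w t * sin (\<theta> t))\<^sup>2
        = q t - 2 * w t * (v1 t * cos (\<theta> t) + v2 t * sin (\<theta> t))
          + w t * w t * ((sin (\<theta> t))\<^sup>2 + (cos (\<theta> t))\<^sup>2)"
      unfolding q_def by algebra
    ultimately show ?thesis
      using ww[of t] by simp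
  qed
  then have polar: "v1 t = w t * cos (\<theta> t)" "v2 t = w t * sin (\<theta> t)" for t
    by (simp_all add: sum_power2_eq_zero_iff)
  show thesis
    by (rule that[OF \<theta>'[unfolded g_def q_def] polar[unfolded w_def q_def]])
qed

text \<open>The total turning is the integral of the curvature with respect to arclength, so the hypotheses confine it to
  \<open>[3/2 * pi, 5/2 * pi]\<close>. It is also a multiple of \<open>2 * pi\<close>, because the tangent is periodic;
  this leaves only \<open>2 * pi\<close>. The bounds \<open>3/4\<close> and \<open>5/4\<close> further give the pinching, as
  \<open>5/4 < 2 * (3/4)\<close>.\<close>
lemma curve_turns:
  fixes \<kappa> :: "real^2 \<Rightarrow> real"
  assumes par: "smooth_closed_parametrization \<gamma> X"
    and \<kappa>: "\<And>t. \<kappa> (\<gamma> t) = signed_curvature \<gamma> t"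
    and lower: "3 / 4 \<le> curve_length \<gamma> / (2 * pi) * (INF x\<in>X. \<kappa> x)"
    and upper: "curve_length \<gamma> / (2 * pi) * (SUP x\<in>X. \<kappa> x) \<le> 5 / 4"
  obtains w \<theta> where "turning_curve \<gamma> w \<theta> (\<lambda>t. \<kappa> (\<gamma> t)) (SUP x\<in>X. \<kappa> x)" "range \<gamma> = X"
proof -
  define v where "v = velocity \<gamma>"
  define a where "a = velocity v"
  define w where "w t = norm (v t)" for t
  define k where "k t = \<kappa> (\<gamma> t)" for t
  have diff: "(velocity ^^ n) \<gamma> differentiable at t" for n t
    using par by (simp add: smooth_closed_parametrization_def smooth_map_def)
  have \<gamma>': "(\<gamma> has_vector_derivative v t) (at t)" for t
    using diff[of 0 t] by (simp add: v_def velocity_def vector_derivative_works)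
  have v': "(v has_vector_derivative a t) (at t)" for t
    using diff[of 1 t] by (simp add: a_def v_def velocity_def vector_derivative_works)
  have a_cont: "continuous_on UNIV a"
    using diff[of 2] by (auto simp: a_def v_def numeral_2_eq_2
        intro!: continuous_at_imp_continuous_on differentiable_imp_continuous_within)
  have v_ne: "v t \<noteq> 0" and per: "\<gamma> (t + 1) = \<gamma> t" for t
    using par by (simp_all add: smooth_closed_parametrization_def v_def)
  have X: "\<gamma> ` {0..1} = X"
    using par by (simp add: smooth_closed_parametrization_def path_image_def)
  have range: "range \<gamma> = X"
  proof -
    have "\<gamma> t \<in> \<gamma> ` {0..1}" for t
      using periodic_frac[of \<gamma> t, OF per] frac_lt_1[of t] frac_ge_0[of t]
      by (metis atLeastAtMost_iff imageI less_imp_le)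
    then show ?thesis using X by auto
  qed
  have w_sq: "(w t)\<^sup>2 = (v t $ 1)\<^sup>2 + (v t $ 2)\<^sup>2" for t
    by (simp add: w_def power2_norm_eq_inner inner_real2 flip: power2_eq_square)
  have w: "w t > 0" for t
    using v_ne by (simp add: w_def)
  have v_comp: "((\<lambda>s. v s $ i) has_real_derivative a t $ i) (at t)" for i t
    using bounded_linear.has_vector_derivative[OF bounded_linear_vec_nth v'[of t], of i]
    by (simp add: has_real_derivative_iff_has_vector_derivative)
  have w_sqrt: "sqrt ((v t $ 1)\<^sup>2 + (v t $ 2)\<^sup>2) = w t" for t
    using w[of t] by (simp flip: w_sq)
  obtain \<theta> where \<theta>:
    "\<And>t. (\<theta> has_real_derivative (v t $ 1 * a t $ 2 - v t $ 2 * a t $ 1) / ((v t $ 1)\<^sup>2 + (v t $ 2)\<^sup>2)) (at t)"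
    "\<And>t. v t $ 1 = w t * cos (\<theta> t)" "\<And>t. v t $ 2 = w t * sin (\<theta> t)"
  proof (rule angle_function[OF v_comp v_comp])
    show "continuous_on UNIV (\<lambda>t. a t $ 1)" "continuous_on UNIV (\<lambda>t. a t $ 2)"
      using a_cont by (auto intro!: continuous_intros)
    show "0 < (v t $ 1)\<^sup>2 + (v t $ 2)\<^sup>2" for t
      using w[of t] by (simp flip: w_sq)
  qed (use that w_sqrt in auto)
  have k: "k t * w t = (v t $ 1 * a t $ 2 - v t $ 2 * a t $ 1) / ((v t $ 1)\<^sup>2 + (v t $ 2)\<^sup>2)" for t
  proof -
    have "k t = (v t $ 1 * a t $ 2 - v t $ 2 * a t $ 1) / w t ^ 3"
      by (simp add: k_def \<kappa> signed_curvature_def v_def a_def w_def)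
    then show ?thesis
      unfolding w_sq[symmetric] using w[of t] by (simp add: power2_eq_square power3_eq_cube)
  qed
  have \<theta>': "(\<theta> has_real_derivative k t * w t) (at t)" for t
    unfolding k by (rule \<theta>)
  have v_dir: "v t = w t *\<^sub>R dir (\<theta> t)" for t
    by (simp add: vec_eq_iff forall_2 dir_def \<theta>)
  have v_cont: "continuous_on UNIV v"
    using v' by (meson has_vector_derivative_continuous continuous_at_imp_continuous_on)
  have w_cont: "continuous_on UNIV w"
    unfolding w_def using v_cont by (intro continuous_intros)
  have "continuous_on UNIV (\<lambda>t. (v t $ 1 * a t $ 2 - v t $ 2 * a t $ 1) / w t ^ 3)"
    using w by (intro continuous_intros v_cont a_cont w_cont) (metis less_irrefl power_eq_0_iff)
  then have k_cont: "continuous_on UNIV k"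
    by (simp add: k_def \<kappa> signed_curvature_def v_def a_def w_def)
  have "\<kappa> ` X = k ` {0..1}"
    by (auto simp: k_def simp flip: X)
  moreover have "bounded (k ` {0..1})"
    by (intro compact_imp_bounded compact_continuous_image continuous_on_subset[OF k_cont]) auto
  ultimately have bdd: "bdd_below (\<kappa> ` X)" "bdd_above (\<kappa> ` X)"
    by (simp_all add: bounded_imp_bdd_below bounded_imp_bdd_above)
  define I where "I = (INF x\<in>X. \<kappa> x)"
  define S where "S = (SUP x\<in>X. \<kappa> x)"
  define L where "L = curve_length \<gamma>"
  have kI: "I \<le> k t" and kS: "k t \<le> S" for t
    unfolding k_def I_def S_def using range bdd
    by (auto intro!: cINF_lower cSUP_upper)
  have int_w: "w integrable_on {0..1}"
    using w_cont by (meson continuous_on_subset integrable_continuous_interval top_greatest)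
  have L: "L = integral {0..1} w"
    by (simp add: L_def curve_length_def w_def[abs_def] v_def)
  have L_nonneg: "L \<ge> 0"
    unfolding L by (rule integral_nonneg[OF int_w]) (simp add: w less_imp_le)
  have turning: "((\<lambda>t. k t * w t) has_integral (\<theta> 1 - \<theta> 0)) {0..1}"
    using \<theta>' by (intro fundamental_theorem_of_calculus)
      (auto simp: has_real_derivative_iff_has_vector_derivative intro: has_vector_derivative_at_within)
  have mono: "I * w t \<le> k t * w t" "k t * w t \<le> S * w t" for t
    using kI kS w by (simp_all add: mult_right_mono less_imp_le)
  have "I * L \<le> \<theta> 1 - \<theta> 0"
  proof (rule has_integral_le)
    show "((\<lambda>t. I * w t) has_integral I * L) {0..1}"
      unfolding L using int_w by (intro has_integral_mult_right) (rule integrable_integral)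
  qed (fact turning, rule mono)
  moreover have "\<theta> 1 - \<theta> 0 \<le> S * L"
  proof (rule has_integral_le)
    show "((\<lambda>t. S * w t) has_integral S * L) {0..1}"
      unfolding L using int_w by (intro has_integral_mult_right) (rule integrable_integral)
  qed (fact turning, rule mono)
  moreover have IL: "3 / 4 * (2 * pi) \<le> I * L" "S * L \<le> 5 / 4 * (2 * pi)"
    using lower upper unfolding I_def[symmetric] S_def[symmetric] L_def[symmetric]
    by (simp_all add: field_simps)
  ultimately have range_turn: "3 / 2 * pi \<le> \<theta> 1 - \<theta> 0" "\<theta> 1 - \<theta> 0 \<le> 5 / 2 * pi"
    by linarith+
  have v_per: "v (t + 1) = v t" for t
    unfolding v_def using \<gamma>' per by (intro velocity_periodic) (simp_all add: v_def)
  then have w_per: "w (t + 1) = w t" for t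
    by (simp add: w_def)
  have "cos (\<theta> 1 - \<theta> 0) = 1"
  proof -
    have "w 0 *\<^sub>R dir (\<theta> 1) = w 0 *\<^sub>R dir (\<theta> 0)"
      using v_per[of 0] w_per[of 0] v_dir[of 0] v_dir[of 1] by simp
    then have "dir (\<theta> 1) = dir (\<theta> 0)"
      using w[of 0] by simp
    then show ?thesis
      by (metis inner_dir_dir cos_zero diff_self)
  qed
  then obtain n :: int where n: "\<theta> 1 - \<theta> 0 = n * (2 * pi)"
    by (auto simp: cos_one_2pi_int)
  then have "n = 1"
  proof -
    have "3 / 2 * pi \<le> n * 2 * pi" "n * 2 * pi \<le> 5 / 2 * pi"
      using range_turn n by simp_all
    then have "3 / 2 \<le> real_of_int n * 2" "real_of_int n * 2 \<le> 5 / 2"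
      by (simp_all only: mult_le_cancel_right_pos pi_gt_zero)
    then show ?thesis by linarith
  qed
  have turn: "\<theta> (t + 1) = \<theta> t + 2 * pi" for t
  proof -
    have "((\<lambda>t. \<theta> (t + 1) - \<theta> t) has_real_derivative 0) (at t)" for t
    proof -
      have "((\<lambda>t. \<theta> (t + 1)) has_real_derivative k (t + 1) * w (t + 1)) (at t)"
        using \<theta>'[of "t + 1"] by (simp add: DERIV_shift)
      from DERIV_diff[OF this \<theta>'[of t]] show ?thesis
        by (simp add: k_def per w_per)
    qed
    then have "\<theta> (t + 1) - \<theta> t = \<theta> (0 + 1) - \<theta> 0"
      using DERIV_isconst_all by blast
    then show ?thesis using n \<open>n = 1\<close> by simp
  qed
  have "S * L < 2 * I * L"
  proof -
    have "5 / 4 * (2 * pi) < 2 * (3 / 4 * (2 * pi))" using pi_gt_zero by simp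
    then show ?thesis using IL by linarith
  qed
  then have SI: "S < 2 * I"
    using L_nonneg by (rule mult_right_less_imp_less)
  have "turning_curve \<gamma> w \<theta> k S"
  proof
    show "S < 2 * k t" for t
      using SI kI[of t] by linarith
  qed (use \<gamma>' v_dir \<theta>' w per turn kS in auto)
  moreover have "k = (\<lambda>t. \<kappa> (\<gamma> t))"
    by (simp add: k_def fun_eq_iff)
  ultimately have "turning_curve \<gamma> w \<theta> (\<lambda>t. \<kappa> (\<gamma> t)) (SUP x\<in>X. \<kappa> x)"
    by (simp only: S_def)
  then show thesis
    using range by (rule that)
qed

section \<open>The equilibrium measure\<close>

theorem mainTheorem2:
  shows "\<exists>\<epsilon>\<^sub>0::real. \<epsilon>\<^sub>0 > 0 \<and>
    (\<forall>(X :: (real^2) set) (\<gamma> :: real \<Rightarrow> real^2) (\<kappa> :: real^2 \<Rightarrow> real).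
       smooth_closed_parametrization \<gamma> X \<longrightarrow>
       strictly_convex_curve X \<longrightarrow>
       (\<forall>t. \<kappa> (\<gamma> t) = signed_curvature \<gamma> t) \<longrightarrow>
       1 - \<epsilon>\<^sub>0 \<le> curve_length \<gamma> / (2 * pi) * (INF x\<in>X. \<kappa> x) \<longrightarrow>
       curve_length \<gamma> / (2 * pi) * (INF x\<in>X. \<kappa> x) \<le> curve_length \<gamma> / (2 * pi) * (SUP x\<in>X. \<kappa> x) \<longrightarrow>
       curve_length \<gamma> / (2 * pi) * (SUP x\<in>X. \<kappa> x) \<le> 1 + \<epsilon>\<^sub>0 \<longrightarrow>
       (\<exists>\<mu> :: (real^2) measure.
          prob_space \<mu> \<and> sets \<mu> = sets (restrict_space borel X) \<and>
          (\<lambda>x. \<integral>y. norm (x - y) \<partial>\<mu>) constant_on X))"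
proof (intro exI[of _ "1/4 :: real"] conjI allI impI)
  fix X :: "(real^2) set" and \<gamma> :: "real \<Rightarrow> real^2" and \<kappa> :: "real^2 \<Rightarrow> real"
  assume par: "smooth_closed_parametrization \<gamma> X"
    and \<kappa>: "\<forall>t. \<kappa> (\<gamma> t) = signed_curvature \<gamma> t"
    and lower: "1 - 1/4 \<le> curve_length \<gamma> / (2 * pi) * (INF x\<in>X. \<kappa> x)"
    and upper: "curve_length \<gamma> / (2 * pi) * (SUP x\<in>X. \<kappa> x) \<le> 1 + 1/4"
  obtain w \<theta> where "turning_curve \<gamma> w \<theta> (\<lambda>t. \<kappa> (\<gamma> t)) (SUP x\<in>X. \<kappa> x)" and X: "range \<gamma> = X"
  proof (rule curve_turns[OF par])
    show "\<kappa> (\<gamma> t) = signed_curvature \<gamma> t" for t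
      using \<kappa> by blast
    have "1 - 1/4 = (3/4 :: real)" "1 + 1/4 = (5/4 :: real)"
      by simp_all
    then show "3/4 \<le> curve_length \<gamma> / (2 * pi) * (INF x\<in>X. \<kappa> x)"
      and "curve_length \<gamma> / (2 * pi) * (SUP x\<in>X. \<kappa> x) \<le> 5/4"
      using lower upper by (simp_all only:)
  qed (rule that)
  then interpret turning_curve \<gamma> w \<theta> "\<lambda>t. \<kappa> (\<gamma> t)" "SUP x\<in>X. \<kappa> x"
    by (simp only:)
  show "\<exists>\<mu> :: (real^2) measure.
      prob_space \<mu> \<and> sets \<mu> = sets (restrict_space borel X) \<and>
      (\<lambda>x. \<integral>y. norm (x - y) \<partial>\<mu>) constant_on X"
  proof (rule equalizing_measure)
    fix \<mu> :: "(real^2) measure"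
    assume "prob_space \<mu>" "sets \<mu> = sets (restrict_space borel (range \<gamma>))"
      "(\<lambda>x. \<integral>y. norm (x - y) \<partial>\<mu>) constant_on (range \<gamma>)"
    then show ?thesis
      unfolding X by (intro exI[of _ \<mu>] conjI)
  qed
qed simp

end
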